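(* Let $\mathcal{X}^{k}_{m}\in\mathbb{R}^{n_1\times\cdots\times n_d}$ be the $m$-th tensor in the accumulation $\mathcal{X}^{k}$ at time $k$, and let $\mathbf{H}_{\mathcal{X}^k}$ be the batch hierarchical Tucker approximation of $\mathcal{X}^k$ computed using the algorithm HT-RISE (described in the context), with cores $\mathcal{G}^{k}_{\ell,j}$. For any $t\ge k$, let $\mathbf{H}_{\mathcal{X}^t}$ be the approximation obtained at time $t$ by continuing HT-RISE on the stream, and let $\tilde{\mathcal{X}}^{t}_{m}$ denote the reconstruction of the $m$-th tensor from $\mathbf{H}_{\mathcal{X}^t}$. Then $\tilde{\mathcal{X}}^{t}_{m}$ equals the reconstruction of the $m$-th tensor from $\mathbf{H}_{\mathcal{X}^k}$, i.e. $\tilde{\mathcal{X}}^{k}_{m}=\tilde{\mathcal{X}}^{t}_{m}$.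
   Context: Stream and accumulation. A tensor stream is a sequence $\mathcal{Y}^1,\mathcal{Y}^2,\dots$ with $\mathcal{Y}^k\in\mathbb{R}^{n_1\times\cdots\times n_d\times N^k}$ ($N^k$-batches of $d$-dimensional tensors, $d\ge2$). The accumulation $\mathcal{X}^k\in\mathbb{R}^{n_1\times\cdots\times n_d\times \mathbf{n}^k}$, $\mathbf{n}^k=\sum_{i=1}^kN^i$, is the concatenation of $\mathcal{Y}^1,\dots,\mathcal{Y}^k$ along the last mode; its $m$-th tensor ($1\le m\le\mathbf{n}^k$) is the slice with last index $m$. Dimension tree. A fixed binary tree $\mathbf{T}$ with $2d-1$ nodes $\mathbf{N}_{\ell,j}$, where $\ell=0,\dots,p$ is the layer (distance from the root $\mathbf{N}_{0,1}$) and $j=1,\dots,|\mathbf{T}_\ell|$. Its $d$ leaves are in bijection with the dimensions $1,\dots,d$; every non-leaf node has two ordered successors in the next layer. Non-root, non-leaf nodes are called transfer nodes. The tree is balanced: $p=\lceil\log_2 d\rceil$, and leaves occur only in layers $p$ and $p-1$. The dimensions are arranged so that siblings are adjacent. Batch hierarchical Tucker format. A leaf for dimension $i$ carries a core $\mathcal{G}_{\ell,j}\in\mathbb{R}^{n_i\times r_{\ell,j}}$; a transfer node with successors $\mathbf{N}_{\ell+1,a},\mathbf{N}_{\ell+1,b}$ carries $\mathcal{G}_{\ell,j}\in\mathbb{R}^{r_{\ell+1,a}\times r_{\ell+1,b}\times r_{\ell,j}}$; the root carries $\mathcal{G}_{0,1}\in\mathbb{R}^{r_{1,1}\times r_{1,2}\times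 M}$, where $M$ is the number of represented tensors. The reconstruction of the $m$-th tensor is the full contraction, along the edges of $\mathbf{T}$, of the root slice $\mathcal{G}_{0,1}(:,:,m)$ with all the other cores (the last mode of each non-root core is contracted with the corresponding one of the first two modes of its parent's core; for the root's successors, with the corresponding mode of the root slice). For a leaf set $U_{\ell,j}=\mathcal{G}_{\ell,j}$; for a transfer node let $U_{\ell,j}$ be $\mathcal{G}_{\ell,j}$ reshaped to an $(r_{\ell+1,a}r_{\ell+1,b})\times r_{\ell,j}$ matrix. Algorithm HT-RISE. Fix a relative tolerance $\varepsilon_{rel}$. The process starts from a batch hierarchical Tucker representation of the first batch in which all the matrices $U_{\ell,j}$ have orthonormal columns. At step $k$, given the representation $\mathbf{H}_{\mathcal{X}^{k-1}}$ with cores $\mathcal{G}^{k-1}_{\ell,j}$ and the new batch $\mathcal{Y}^k$, put $\varepsilon_{des}=\varepsilon_{rel}\|\mathcal{Y}^k\|_F$ and $\varepsilon_{nw}=\varepsilon_{des}/\sqrt{2d-2}$. Projection: for $\ell=p,\dots,1$ successively contract, for every node of layer $\ell$, the corresponding mode of the current tensor (initially $\mathcal{Y}^k$) with the transpose $(U^{k-1}_{\ell,j})^T$; after each layer reshape so that the modes of the successors of each transfer node of layer $\ell-1$ are merged into one mode. The batch mode is untouched. The result is $\mathcal{C}\in\mathbb{R}^{r^{k-1}_{1,1}\times r^{k-1}_{1,2}\times N^k}$. If $\sqrt{\|\mathcal{Y}^k\|_F^2-\|\mathcal{C}\|_F^2}\le\varepsilon_{des}$, all non-root cores are kept unchanged,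 and the root becomes the concatenation of $\mathcal{G}^{k-1}_{0,1}$ and $\mathcal{C}$ along the third mode. Otherwise, set $\mathcal{C}_p=\mathcal{Y}^k$ and for $\ell=p,\dots,1$ do the following. For each node $\mathbf{N}_{\ell,j}$ of layer $\ell$: let $C$ be the unfolding of $\mathcal{C}_\ell$ in the mode of that node (rows indexed by that mode), let $R=(I-U^{k-1}_{\ell,j}(U^{k-1}_{\ell,j})^T)C$, and let $U_R$ be the matrix of left singular vectors of a truncated SVD of $R$ with truncation error at most $\varepsilon_{nw}$ in Frobenius norm; let $r_R$ be its number of columns. Replace $U^{k-1}_{\ell,j}$ by $U^k_{\ell,j}=[\,U^{k-1}_{\ell,j}\;\;U_R\,]$ (reshaped back to a three-way core $\mathcal{G}^k_{\ell,j}$ for a transfer node), and pad the core of the parent node (in layer $\ell-1$, possibly the root) with zeros: if $\mathbf{N}_{\ell,j}$ is the $s$-th successor of its parent ($s\in\{1,2\}$), append $r_R$ zero slices at the end of the parent core's $s$-th mode. The padded core plays the role of $\mathcal{G}^{k-1}_{\ell-1,\cdot}$ when layer $\ell-1$ is processed. After all the nodes of layer $\ell$ have been updated, contract $\mathcal{C}_\ell$ in the modes of layer $\ell$ with the matrices $(U^k_{\ell,j})^T$, obtaining $\bar{\mathcal{C}}_\ell$, and (if $\ell>1$) reshape it, merging the modes of siblings, into $\mathcal{C}_{\ell-1}$. Finally, the new root $\mathcal{G}^k_{0,1}$ is the concatenation along the third mode of the zero-padded old root and $\bar{\mathcal{C}}_1\in\mathbb{R}^{r^k_{1,1}\times r^k_{1,2}\times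 N^k}$. *)

theory Defs
  imports Complex_Main "HOL-Library.FuncSet" "Jordan_Normal_Form.Matrix"
begin

text \<open>Modes, mode indices and the numbers of the tensors in a batch all count from 0.\<close>

definition index_set :: "nat list \<Rightarrow> nat list set" where
  "index_set s = {i. length i = length s \<and> (\<forall>j < length s. i ! j < s ! j)}"

text \<open>A tensor is its list of mode sizes together with its entries; entries outside the index set
  are fixed to 0, so that equality of tensors is equality of shapes and of all entries.\<close>

typedef tensor = "{(s, f :: nat list \<Rightarrow> real). \<forall>i. i \<notin> index_set s \<longrightarrow> f i = 0}"
  by (rule exI[of _ "([], \<lambda>_. 0)"]) simp

setup_lifting type_definition_tensor

lift_definition tensor :: "nat list \<Rightarrow> (nat list \<Rightarrow> real) \<Rightarrow> tensor"
  is "\<lambda>s f. (s, \<lambda>i. if i \<in> index_set s then f i else 0)" by simp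

lift_definition dims :: "tensor \<Rightarrow> nat list" is fst .

lift_definition entry :: "tensor \<Rightarrow> nat list \<Rightarrow> real" is snd .

lemma dims_tensor [simp]: "dims (tensor s f) = s"
  by transfer simp

lemma entry_tensor [simp]: "entry (tensor s f) i = (if i \<in> index_set s then f i else 0)"
  by transfer simp

lemma entry_outside: "i \<notin> index_set (dims X) \<Longrightarrow> entry X i = 0"
  by transfer auto

lemma tensor_eqI:
  assumes "dims X = dims Z" and "\<And>i. i \<in> index_set (dims X) \<Longrightarrow> entry X i = entry Z i"
  shows "X = Z"
  using assms
proof transfer
  fix X Z :: "nat list \<times> (nat list \<Rightarrow> real)"
  assume X: "X \<in> {(s, f). \<forall>i. i \<notin> index_set s \<longrightarrow> f i = 0}"
    and Z: "Z \<in> {(s, f). \<forall>i. i \<notin> index_set s \<longrightarrow> f i = 0}"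
    and d: "fst X = fst Z" and e: "\<And>i. i \<in> index_set (fst X) \<Longrightarrow> snd X i = snd Z i"
  have "snd X i = snd Z i" for i
    using X Z d e[of i] by (cases "i \<in> index_set (fst X)") (auto split: prod.splits)
  then show "X = Z"
    using d by (simp add: prod_eq_iff fun_eq_iff)
qed

text \<open>Column-major linearisation of multi-indices (the first index runs fastest), and its inverse.\<close>

fun lin :: "nat list \<Rightarrow> nat list \<Rightarrow> nat" where
  "lin (n # s) (i # is) = i + n * lin s is"
| "lin _ _ = 0"

fun unlin :: "nat list \<Rightarrow> nat \<Rightarrow> nat list" where
  "unlin [] c = []"
| "unlin (n # s) c = c mod n # unlin s (c div n)"

text \<open>Meaningful only if both shapes have the same number of entries.\<close>

definition reshape :: "nat list \<Rightarrow> tensor \<Rightarrow> tensor" where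
  "reshape s X = tensor s (\<lambda>i. entry X (unlin (dims X) (lin s i)))"

definition fnorm :: "tensor \<Rightarrow> real" where
  "fnorm X = sqrt (\<Sum>i \<in> index_set (dims X). (entry X i)\<^sup>2)"

definition mode_prod :: "nat \<Rightarrow> real mat \<Rightarrow> tensor \<Rightarrow> tensor" where
  "mode_prod q A X = tensor ((dims X)[q := dim_row A])
     (\<lambda>i. \<Sum>j < dims X ! q. A $$ (i ! q, j) * entry X (i[q := j]))"

definition unfolding_mat :: "nat \<Rightarrow> tensor \<Rightarrow> real mat" where
  "unfolding_mat q X =
     (let s = take q (dims X) @ drop (Suc q) (dims X) in
      mat (dims X ! q) (prod_list s)
        (\<lambda>(a, c). entry X (take q (unlin s c) @ a # drop q (unlin s c))))"

definition concat_last :: "tensor \<Rightarrow> tensor \<Rightarrow> tensor" where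
  "concat_last X Z = tensor (butlast (dims X) @ [last (dims X) + last (dims Z)])
     (\<lambda>i. if last i < last (dims X) then entry X i
          else entry Z (butlast i @ [last i - last (dims X)]))"

definition pad_zeros :: "nat \<Rightarrow> nat \<Rightarrow> tensor \<Rightarrow> tensor" where
  "pad_zeros q r X = tensor ((dims X)[q := dims X ! q + r])
     (\<lambda>i. if i ! q < dims X ! q then entry X i else 0)"

text \<open>All modes but the last one are merged into the rows. Applied to a core this gives the core
  itself at a leaf and its reshaped matrix at a transfer node.\<close>

definition mat_of_tensor :: "tensor \<Rightarrow> real mat" where
  "mat_of_tensor X =
     mat (prod_list (butlast (dims X))) (last (dims X)) (\<lambda>(a, c). entry X (unlin (butlast (dims X)) a @ [c]))"

definition tensor_of_mat :: "nat list \<Rightarrow> real mat \<Rightarrow> tensor" where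
  "tensor_of_mat s A = tensor (s @ [dim_col A]) (\<lambda>i. A $$ (lin s (butlast i), last i))"

definition mat_fnorm :: "real mat \<Rightarrow> real" where
  "mat_fnorm A = sqrt (\<Sum>i < dim_row A. \<Sum>j < dim_col A. (A $$ (i, j))\<^sup>2)"

definition orthonormal_cols :: "real mat \<Rightarrow> bool" where
  "orthonormal_cols A \<longleftrightarrow> transpose_mat A * A = 1\<^sub>m (dim_col A)"

definition append_cols :: "real mat \<Rightarrow> real mat \<Rightarrow> real mat" where
  "append_cols A B = mat (dim_row A) (dim_col A + dim_col B)
     (\<lambda>(i, j). if j < dim_col A then A $$ (i, j) else B $$ (i, j - dim_col A))"

definition take_cols :: "nat \<Rightarrow> real mat \<Rightarrow> real mat" where
  "take_cols r A = mat (dim_row A) r (\<lambda>(i, j). A $$ (i, j))"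

definition thin_svd :: "real mat \<Rightarrow> real mat \<Rightarrow> real list \<Rightarrow> real mat \<Rightarrow> bool" where
  "thin_svd A P \<sigma> Q \<longleftrightarrow>
     (let k = min (dim_row A) (dim_col A) in
      length \<sigma> = k \<and> sorted_wrt (\<ge>) \<sigma> \<and> (\<forall>x \<in> set \<sigma>. 0 \<le> x) \<and>
      P \<in> carrier_mat (dim_row A) k \<and> orthonormal_cols P \<and>
      Q \<in> carrier_mat (dim_col A) k \<and> orthonormal_cols Q \<and>
      A = P * mat_diag k (\<lambda>i. \<sigma> ! i) * transpose_mat Q)"

text \<open>\<open>W\<close> consists of the left singular vectors of some truncated SVD of \<open>A\<close> with error at most \<open>\<delta>\<close>;
  the truncation rank need not be the smallest one.\<close>

definition left_truncated_svd :: "real \<Rightarrow> real mat \<Rightarrow> real mat \<Rightarrow> bool" where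
  "left_truncated_svd \<delta> A W \<longleftrightarrow>
     (\<exists>P \<sigma> Q r. thin_svd A P \<sigma> Q \<and> r \<le> length \<sigma> \<and> W = take_cols r P \<and>
        mat_fnorm (A - take_cols r P * mat_diag r (\<lambda>i. \<sigma> ! i) * transpose_mat (take_cols r Q)) \<le> \<delta>)"

text \<open>A node is addressed by the path from the root to it (\<open>False\<close>: first successor, \<open>True\<close>: second
  successor), so its layer is the length of the path. Leaves are labelled by dimensions.\<close>

datatype dim_tree = Leaf nat | Node dim_tree dim_tree

type_synonym path = "bool list"

fun leaf_dims :: "dim_tree \<Rightarrow> nat list" where
  "leaf_dims (Leaf i) = [i]"
| "leaf_dims (Node a b) = leaf_dims a @ leaf_dims b"

fun height :: "dim_tree \<Rightarrow> nat" where
  "height (Leaf i) = 0"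
| "height (Node a b) = Suc (max (height a) (height b))"

fun subtree_at :: "dim_tree \<Rightarrow> path \<Rightarrow> dim_tree option" where
  "subtree_at t [] = Some t"
| "subtree_at (Node a b) (s # x) = subtree_at (if s then b else a) x"
| "subtree_at (Leaf i) (s # x) = None"

definition nodes :: "dim_tree \<Rightarrow> path set" where
  "nodes T = {x. subtree_at T x \<noteq> None}"

definition is_leaf :: "dim_tree \<Rightarrow> path \<Rightarrow> bool" where
  "is_leaf T x \<longleftrightarrow> (\<exists>i. subtree_at T x = Some (Leaf i))"

definition balanced :: "dim_tree \<Rightarrow> bool" where
  "balanced T \<longleftrightarrow> int (height T) = \<lceil>log 2 (real (length (leaf_dims T)))\<rceil> \<and>
     (\<forall>x. is_leaf T x \<longrightarrow> length x = height T \<or> Suc (length x) = height T)"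

text \<open>\<open>modes T l\<close> lists the nodes carrying the non-batch modes of a tensor on which all layers below
  \<open>l\<close> have been processed: the nodes of layer \<open>l\<close> and the leaves of the layers above it, from left
  to right. For \<open>l = height T\<close> these are the leaves. In a balanced tree, they are just the nodes of
  layer \<open>l\<close> for all smaller \<open>l\<close>.\<close>

fun modes :: "dim_tree \<Rightarrow> nat \<Rightarrow> path list" where
  "modes T 0 = [[]]"
| "modes (Leaf i) (Suc l) = [[]]"
| "modes (Node a b) (Suc l) = map (Cons False) (modes a l) @ map (Cons True) (modes b l)"

definition layer :: "dim_tree \<Rightarrow> nat \<Rightarrow> path list" where
  "layer T l = filter (\<lambda>x. length x = l) (modes T l)"

definition mode_of :: "dim_tree \<Rightarrow> nat \<Rightarrow> path \<Rightarrow> nat" where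
  "mode_of T l x = length (takeWhile (\<lambda>y. y \<noteq> x) (modes T l))"

type_synonym bht = "path \<Rightarrow> tensor"

definition rank :: "bht \<Rightarrow> path \<Rightarrow> nat" where
  "rank G x = last (dims (G x))"

definition bht_format :: "dim_tree \<Rightarrow> nat list \<Rightarrow> nat \<Rightarrow> bht \<Rightarrow> bool" where
  "bht_format T n M G \<longleftrightarrow>
     (\<forall>x \<in> nodes T. dims (G x) =
        (case the (subtree_at T x) of
           Leaf i \<Rightarrow> [n ! i, rank G x]
         | Node _ _ \<Rightarrow> [rank G (x @ [False]), rank G (x @ [True]), rank G x])) \<and>
     rank G [] = M"

definition core_mat :: "bht \<Rightarrow> path \<Rightarrow> real mat" where
  "core_mat G x = mat_of_tensor (G x)"

text \<open>Entry of a core in the full contraction, for the values \<open>i\<close> of the dimension indices and the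
  values \<open>k\<close> of the rank indices, where \<open>k x\<close> belongs to the edge between \<open>x\<close> and its parent
  (for the root, \<open>k []\<close> is the batch index).\<close>

definition core_entry :: "dim_tree \<Rightarrow> bht \<Rightarrow> nat list \<Rightarrow> (path \<Rightarrow> nat) \<Rightarrow> path \<Rightarrow> real" where
  "core_entry T G i k x = entry (G x)
     (case the (subtree_at T x) of
        Leaf j \<Rightarrow> [i ! j, k x]
      | Node _ _ \<Rightarrow> [k (x @ [False]), k (x @ [True]), k x])"

definition reconstruct :: "dim_tree \<Rightarrow> bht \<Rightarrow> nat \<Rightarrow> tensor" where
  "reconstruct T G m = tensor (map (\<lambda>x. hd (dims (G x))) (modes T (height T)))
     (\<lambda>i. \<Sum>k \<in> PiE (nodes T - {[]}) (\<lambda>x. {..<rank G x}).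
            \<Prod>x \<in> nodes T. core_entry T G i (k([] := m)) x)"

definition contract_layer :: "dim_tree \<Rightarrow> nat \<Rightarrow> bht \<Rightarrow> tensor \<Rightarrow> tensor" where
  "contract_layer T l G C =
     fold (\<lambda>x. mode_prod (mode_of T l x) (transpose_mat (core_mat G x))) (layer T l) C"

text \<open>Siblings occupy adjacent modes, so merging them column-major is a mere change of shape.\<close>

definition merge_siblings :: "dim_tree \<Rightarrow> nat \<Rightarrow> tensor \<Rightarrow> tensor" where
  "merge_siblings T l C =
     (let sz = (\<lambda>x. dims C ! mode_of T l x) in
      reshape (map (\<lambda>x. if is_leaf T x then sz x else sz (x @ [False]) * sz (x @ [True])) (modes T (l - 1))
               @ [last (dims C)]) C)"

definition process_layer :: "dim_tree \<Rightarrow> nat \<Rightarrow> bht \<Rightarrow> tensor \<Rightarrow> tensor" where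
  "process_layer T l G C =
     (if l > 1 then merge_siblings T l (contract_layer T l G C) else contract_layer T l G C)"

text \<open>\<open>project T G l\<close> processes the layers \<open>l, \<dots>, 1\<close>.\<close>

primrec project :: "dim_tree \<Rightarrow> bht \<Rightarrow> nat \<Rightarrow> tensor \<Rightarrow> tensor" where
  "project T G 0 C = C"
| "project T G (Suc l) C = project T G l (process_layer T (Suc l) G C)"

text \<open>One node \<open>x\<close> of layer \<open>l\<close>: its parent is \<open>butlast x\<close>, and \<open>last x\<close> tells whether it is the
  first or the second successor.\<close>

definition expand_node :: "dim_tree \<Rightarrow> real \<Rightarrow> nat \<Rightarrow> tensor \<Rightarrow> path \<Rightarrow> bht \<Rightarrow> bht \<Rightarrow> bool" where
  "expand_node T \<delta> l C x G G' \<longleftrightarrow>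
     (let U = core_mat G x;
          A = unfolding_mat (mode_of T l x) C;
          R = (1\<^sub>m (dim_row U) - U * transpose_mat U) * A in
      \<exists>W. left_truncated_svd \<delta> R W \<and>
        G' = G(x := tensor_of_mat (butlast (dims (G x))) (append_cols U W),
               butlast x := pad_zeros (if last x then 1 else 0) (dim_col W) (G (butlast x))))"

primrec expand_nodes :: "dim_tree \<Rightarrow> real \<Rightarrow> nat \<Rightarrow> tensor \<Rightarrow> path list \<Rightarrow> bht \<Rightarrow> bht \<Rightarrow> bool" where
  "expand_nodes T \<delta> l C [] G G' \<longleftrightarrow> G' = G"
| "expand_nodes T \<delta> l C (x # xs) G G' \<longleftrightarrow>
     (\<exists>G1. expand_node T \<delta> l C x G G1 \<and> expand_nodes T \<delta> l C xs G1 G')"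

text \<open>\<open>expand T \<delta> l G C G' C'\<close>: processing the layers \<open>l, \<dots>, 1\<close>, starting with the cores \<open>G\<close> and the
  current tensor \<open>C\<close>, may result in the cores \<open>G'\<close> (with zero-padded root) and the tensor \<open>C'\<close>.\<close>

primrec expand :: "dim_tree \<Rightarrow> real \<Rightarrow> nat \<Rightarrow> bht \<Rightarrow> tensor \<Rightarrow> bht \<Rightarrow> tensor \<Rightarrow> bool" where
  "expand T \<delta> 0 G C G' C' \<longleftrightarrow> G' = G \<and> C' = C"
| "expand T \<delta> (Suc l) G C G' C' \<longleftrightarrow>
     (\<exists>G1. expand_nodes T \<delta> (Suc l) C (layer T (Suc l)) G G1 \<and>
        expand T \<delta> l G1 (process_layer T (Suc l) G1 C) G' C')"

definition append_to_root :: "bht \<Rightarrow> tensor \<Rightarrow> bht" where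
  "append_to_root G C = G([] := concat_last (G []) C)"

text \<open>A relation, since the truncated SVDs are not unique.\<close>

definition ht_rise_step :: "dim_tree \<Rightarrow> real \<Rightarrow> bht \<Rightarrow> tensor \<Rightarrow> bht \<Rightarrow> bool" where
  "ht_rise_step T \<epsilon>_rel G Y G' \<longleftrightarrow>
     (let \<epsilon>_des = \<epsilon>_rel * fnorm Y;
          \<epsilon>_nw = \<epsilon>_des / sqrt (2 * real (length (leaf_dims T)) - 2);
          C = project T G (height T) Y in
      if sqrt ((fnorm Y)\<^sup>2 - (fnorm C)\<^sup>2) \<le> \<epsilon>_des
      then G' = append_to_root G C
      else \<exists>G1 C1. expand T \<epsilon>_nw (height T) G Y G1 C1 \<and> G' = append_to_root G1 C1)"

text \<open>A run on the stream \<open>Y 1, Y 2, \<dots>\<close>, where \<open>H k\<close> is the representation at time \<open>k\<close>. The first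
  representation may approximate the first batch with any accuracy.\<close>

definition ht_rise :: "dim_tree \<Rightarrow> real \<Rightarrow> (nat \<Rightarrow> tensor) \<Rightarrow> (nat \<Rightarrow> bht) \<Rightarrow> bool" where
  "ht_rise T \<epsilon>_rel Y H \<longleftrightarrow>
     bht_format T (butlast (dims (Y 1))) (last (dims (Y 1))) (H 1) \<and>
     (\<forall>x \<in> nodes T - {[]}. orthonormal_cols (core_mat (H 1) x)) \<and>
     (\<forall>k \<ge> 2. ht_rise_step T \<epsilon>_rel (H (k - 1)) (Y k) (H k))"

definition accumulation :: "(nat \<Rightarrow> tensor) \<Rightarrow> nat \<Rightarrow> tensor" where
  "accumulation Y k = foldl concat_last (Y 1) (map Y [2..<Suc k])"

end

theory Submission
  imports Defs
begin

text \<open>An update of HT-RISE only ever enlarges cores. Appending the columns \<open>W\<close> to the matrix of a node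
  \<open>x\<close> lengthens the range of the rank index on the edge between \<open>x\<close> and its parent, and the zeros that
  are padded to the parent's core annihilate every term of the full contraction in which this index
  takes a new value. The terms that survive involve old entries only, so that the contraction is the
  same for every batch index (\<open>expand_node_preserves\<close>). The final concatenation at the root leaves
  all old root slices as they are (\<open>append_to_root_preserves\<close>). Both are facts about the
  shapes of the cores and the places of their old entries.

  Induction over the nodes of a layer, over the layers and over time then gives the theorem,
  once it is known that the number of represented tensors grows in step with the accumulation, so
  that the number \<open>m\<close> of an accumulated tensor belongs to an old root slice in all later updates.
  For this, the projected batch must still have the batch size as its last mode size
  (\<open>last_dims_project\<close>, \<open>expand_preserves\<close>): the processing of a layer acts on the modes before the
  batch mode only.\<close>

section \<open>Nodes and modes of a dimension tree\<close>

lemma subtree_at_append: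
  "subtree_at T (x @ y) = Option.bind (subtree_at T x) (\<lambda>t. subtree_at t y)"
  by (induction T x rule: subtree_at.induct) auto

lemma subtree_at_leaf: "subtree_at (Leaf i) x = (if x = [] then Some (Leaf i) else None)"
  by (cases x) auto

lemma nodes_leaf: "nodes (Leaf i) = {[]}"
  by (auto simp: nodes_def subtree_at_leaf split: if_splits)

lemma nodes_node: "nodes (Node a b) = insert [] (Cons False ` nodes a \<union> Cons True ` nodes b)"
proof (rule Set.set_eqI)
  fix x
  show "x \<in> nodes (Node a b) \<longleftrightarrow> x \<in> insert [] (Cons False ` nodes a \<union> Cons True ` nodes b)"
  proof (cases x)
    case (Cons s y)
    then show ?thesis by (cases s) (auto simp: nodes_def)
  qed (simp add: nodes_def)
qed

lemma finite_nodes: "finite (nodes T)"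
  by (induction T) (simp_all add: nodes_leaf nodes_node)

lemma root_in_nodes: "[] \<in> nodes T"
  by (simp add: nodes_def)

lemma parent_of_node:
  assumes "x @ [s] \<in> nodes T"
  obtains a b where "subtree_at T x = Some (Node a b)"
proof (cases "subtree_at T x")
  case (Some u)
  then show ?thesis
    using assms that by (cases u) (auto simp: nodes_def subtree_at_append)
qed (use assms in \<open>auto simp: nodes_def subtree_at_append\<close>)

lemma modes_subset_nodes: "set (modes T l) \<subseteq> nodes T"
  by (induction T l rule: modes.induct) (auto simp: nodes_node root_in_nodes)

lemma is_leaf_modes:
  assumes "x \<in> set (modes T l)" and "height T \<le> l"
  shows "is_leaf T x"
  using assms
proof (induction T l arbitrary: x rule: modes.induct)
  case (1 T)
  then show ?case by (cases T) (simp_all add: is_leaf_def)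
qed (auto simp: is_leaf_def)

text \<open>At the bottom layer there is one mode for each dimension, as in the tensors of the stream.\<close>

lemma length_modes_height:
  assumes "height T \<le> l"
  shows "length (modes T l) = length (leaf_dims T)"
  using assms
proof (induction T l rule: modes.induct)
  case (1 T)
  then show ?case by (cases T) simp_all
qed simp_all

lemma length_takeWhile_neq_less: "x \<in> set xs \<Longrightarrow> length (takeWhile (\<lambda>y. y \<noteq> x) xs) < length xs"
  by (induction xs) auto

lemma mode_of_less: "x \<in> set (modes T l) \<Longrightarrow> mode_of T l x < length (modes T l)"
  unfolding mode_of_def by (rule length_takeWhile_neq_less)

section \<open>Entries of enlarged cores\<close>

lemma index_set_snoc: "i @ [c] \<in> index_set (s @ [r]) \<longleftrightarrow> i \<in> index_set s \<and> c < r"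
  by (auto simp: index_set_def nth_append less_Suc_eq)

lemma index_set_Cons:
  "i \<in> index_set (n # s) \<longleftrightarrow> (\<exists>c j. i = c # j \<and> c < n \<and> j \<in> index_set s)"
  by (cases i) (auto simp: index_set_def nth_Cons less_Suc_eq_0_disj split: nat.split)

lemma unlin_lin: "i \<in> index_set s \<Longrightarrow> unlin s (lin s i) = i"
  by (induction s arbitrary: i) (auto simp: index_set_Cons, simp add: index_set_def)

lemma lin_less: "i \<in> index_set s \<Longrightarrow> lin s i < prod_list s"
proof (induction s arbitrary: i)
  case (Cons n s)
  then obtain c j where i: "i = c # j" "c < n" "j \<in> index_set s"
    by (auto simp: index_set_Cons)
  have "c + n * lin s j < n * Suc (lin s j)" using i by simp
  also have "\<dots> \<le> n * prod_list s"
    using Cons.IH[OF i(3)] by (intro mult_le_mono2) simp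
  finally show ?case using i by simp
qed simp

lemma dims_tensor_of_mat_append_cols:
  assumes "dims X = s @ [r]"
  shows "dims (tensor_of_mat (butlast (dims X)) (append_cols (mat_of_tensor X) W))
    = s @ [r + dim_col W]"
  using assms by (simp add: tensor_of_mat_def append_cols_def mat_of_tensor_def)

text \<open>Flattening a core to its matrix, appending columns and reshaping back leaves the old entries in
  place because the row indices are linearised for the same row shape \<open>s\<close> in both directions.\<close>

lemma entry_tensor_of_mat_append_cols:
  assumes "dims X = s @ [r]" and "c < r"
  shows "entry (tensor_of_mat (butlast (dims X)) (append_cols (mat_of_tensor X) W)) (i @ [c])
    = entry X (i @ [c])"
proof (cases "i \<in> index_set s")
  case True
  then show ?thesis
    using assms by (simp add: tensor_of_mat_def append_cols_def mat_of_tensor_def index_set_snoc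
        lin_less unlin_lin)
next
  case False
  then show ?thesis
    using assms by (simp add: tensor_of_mat_def append_cols_def mat_of_tensor_def index_set_snoc
        entry_outside)
qed

lemma dims_pad_zeros: "dims (pad_zeros q r X) = (dims X)[q := dims X ! q + r]"
  by (simp add: pad_zeros_def)

lemma entry_pad_zeros_old:
  assumes "i ! q < dims X ! q"
  shows "entry (pad_zeros q r X) i = entry X i"
proof (cases "i \<in> index_set (dims X)")
  case True
  then have i: "length i = length (dims X)" "\<And>j. j < length (dims X) \<Longrightarrow> i ! j < dims X ! j"
    by (auto simp: index_set_def)
  have "i ! j < (dims X)[q := dims X ! q + r] ! j" if "j < length (dims X)" for j
    using i(2)[OF that] that by (cases "j = q") simp_all
  then have "i \<in> index_set ((dims X)[q := dims X ! q + r])"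
    using i(1) by (simp add: index_set_def)
  then show ?thesis using assms by (simp add: pad_zeros_def)
next
  case False
  then show ?thesis by (simp add: pad_zeros_def entry_outside)
qed

lemma entry_pad_zeros_new:
  assumes "dims X ! q \<le> i ! q"
  shows "entry (pad_zeros q r X) i = 0"
  using assms by (simp add: pad_zeros_def)

lemma entry_concat_last_old:
  assumes "dims X = s @ [r]" and "c < r"
  shows "entry (concat_last X Z) (i @ [c]) = entry X (i @ [c])"
  using assms by (auto simp: concat_last_def index_set_snoc entry_outside)

section \<open>Updates that preserve the reconstruction\<close>

lemma bht_format_leaf:
  assumes "bht_format T n M G" and "subtree_at T x = Some (Leaf j)"
  shows "dims (G x) = [n ! j, rank G x]"
  using assms by (force simp: bht_format_def nodes_def)

lemma bht_format_node:
  assumes "bht_format T n M G" and "subtree_at T x = Some (Node a b)"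
  shows "dims (G x) = [rank G (x @ [False]), rank G (x @ [True]), rank G x]"
  using assms by (force simp: bht_format_def nodes_def)

lemma bht_formatI:
  assumes "\<And>x j. subtree_at T x = Some (Leaf j) \<Longrightarrow> dims (G x) = [n ! j, rank G x]"
    and "\<And>x a b. subtree_at T x = Some (Node a b) \<Longrightarrow>
      dims (G x) = [rank G (x @ [False]), rank G (x @ [True]), rank G x]"
    and "rank G [] = M"
  shows "bht_format T n M G"
  using assms unfolding bht_format_def nodes_def by (auto split: dim_tree.splits)

lemma bht_format_snoc:
  assumes "bht_format T n M G" and "x \<in> nodes T"
  obtains s where "dims (G x) = s @ [rank G x]"
  using assms by (cases "the (subtree_at T x)") (auto simp: bht_format_def)

text \<open>The criterion by which two representations of different ranks are compared: the contraction over
  the larger ranks restricts to the one over the smaller ranks as soon as every assignment of the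
  rank indices that leaves the smaller ranks meets a vanishing core entry.\<close>

lemma reconstruct_eqI:
  assumes leaf: "\<And>x. is_leaf T x \<Longrightarrow> hd (dims (G' x)) = hd (dims (G x))"
    and rank: "\<And>x. x \<in> nodes T - {[]} \<Longrightarrow> rank G x \<le> rank G' x"
    and old: "\<And>i k x. \<lbrakk>x \<in> nodes T; k [] = m; \<And>y. y \<in> nodes T - {[]} \<Longrightarrow> k y < rank G y\<rbrakk>
      \<Longrightarrow> core_entry T G' i k x = core_entry T G i k x"
    and new: "\<And>i k y. \<lbrakk>y \<in> nodes T - {[]}; rank G y \<le> k y; k y < rank G' y\<rbrakk>
      \<Longrightarrow> \<exists>x \<in> nodes T. core_entry T G' i k x = 0"
  shows "reconstruct T G' m = reconstruct T G m"
proof -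
  let ?K = "\<lambda>G. PiE (nodes T - {[]}) (\<lambda>x. {..<rank G x})"
  have "(\<Sum>k \<in> ?K G'. \<Prod>x \<in> nodes T. core_entry T G' i (k([] := m)) x)
      = (\<Sum>k \<in> ?K G. \<Prod>x \<in> nodes T. core_entry T G i (k([] := m)) x)" for i
  proof (rule sum.mono_neutral_cong_right)
    show "finite (?K G')"
      by (intro finite_PiE) (simp_all add: finite_nodes)
    show "?K G \<subseteq> ?K G'"
      using rank by (intro PiE_mono) auto
    show "\<forall>k \<in> ?K G' - ?K G. (\<Prod>x \<in> nodes T. core_entry T G' i (k([] := m)) x) = 0"
    proof
      fix k assume k: "k \<in> ?K G' - ?K G"
      then obtain y where y: "y \<in> nodes T - {[]}" "rank G y \<le> k y" "k y < rank G' y"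
        by (auto simp: PiE_iff not_less)
      then have "\<exists>x \<in> nodes T. core_entry T G' i (k([] := m)) x = 0"
        by (intro new) auto
      then show "(\<Prod>x \<in> nodes T. core_entry T G' i (k([] := m)) x) = 0"
        by (simp add: finite_nodes)
    qed
    show "(\<Prod>x \<in> nodes T. core_entry T G' i (k([] := m)) x)
        = (\<Prod>x \<in> nodes T. core_entry T G i (k([] := m)) x)" if "k \<in> ?K G" for k
      using that by (intro prod.cong refl old) (auto simp: PiE_iff)
  qed
  moreover have "map (\<lambda>x. hd (dims (G' x))) (modes T (height T))
      = map (\<lambda>x. hd (dims (G x))) (modes T (height T))"
    by (intro map_cong refl leaf is_leaf_modes) auto
  ultimately show ?thesis by (simp only: reconstruct_def)
qed

lemma hd_dims_leaf_eq:
  assumes "bht_format T n M G" and "bht_format T n M' G'" and "is_leaf T x"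
  shows "hd (dims (G' x)) = hd (dims (G x))"
  using assms by (auto simp: is_leaf_def bht_format_leaf)

text \<open>The node's new columns are reached only by rank indices \<open>k x \<ge> rank G x\<close>. The parent's core is the
  one other core that carries this index, and there it selects a padded zero slice. This also holds
  if the parent is the root, because its padding extends over all batch indices; hence there is no
  bound on \<open>m\<close>.\<close>

lemma expand_node_preserves:
  assumes F: "bht_format T n M G" and x: "x \<in> nodes T" "x \<noteq> []"
    and E: "expand_node T \<delta> l C x G G'"
  shows "bht_format T n M G'" and "reconstruct T G' m = reconstruct T G m"
proof -
  define p s where "p = butlast x" and "s = last x"
  have xp: "x = p @ [s]" using x by (simp add: p_def s_def)
  obtain a b where p: "subtree_at T p = Some (Node a b)"
    using x(1) unfolding xp by (rule parent_of_node)
  \<comment> \<open>the mode of the parent's core that is contracted with the core of \<open>x\<close>\<close>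
  define q :: nat where "q = (if s then 1 else 0)"
  obtain W where G': "G' = G(x := tensor_of_mat (butlast (dims (G x))) (append_cols (mat_of_tensor (G x)) W),
      p := pad_zeros q (dim_col W) (G p))"
    using E by (auto simp: expand_node_def core_mat_def p_def s_def q_def Let_def)
  have px: "p \<noteq> x" by (simp add: xp)
  obtain c where c: "dims (G x) = c @ [rank G x]"
    using bht_format_snoc[OF F x(1)] .
  have G'x: "G' x = tensor_of_mat (butlast (dims (G x))) (append_cols (mat_of_tensor (G x)) W)"
    using px by (simp add: G')
  have G'p: "G' p = pad_zeros q (dim_col W) (G p)"
    by (simp add: G')
  have dx: "dims (G' x) = c @ [rank G x + dim_col W]"
    unfolding G'x using c by (rule dims_tensor_of_mat_append_cols)
  have Gp: "dims (G p) = [rank G (p @ [False]), rank G (p @ [True]), rank G p]"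
    using F p by (rule bht_format_node)
  have Gpq: "dims (G p) ! q = rank G x"
    by (cases s) (simp_all add: Gp q_def xp)
  have dp: "dims (G' p) = (dims (G p))[q := rank G x + dim_col W]"
    by (simp add: G'p dims_pad_zeros Gpq)
  have rx: "rank G' x = rank G x + dim_col W"
    by (simp add: rank_def[of G'] dx)
  have ry: "rank G' y = rank G y" if "y \<noteq> x" for y
  proof (cases "y = p")
    case True
    then show ?thesis by (simp add: rank_def[of G'] dp Gp q_def)
  next
    case False
    then show ?thesis using that by (simp add: rank_def G')
  qed
  have G'y: "G' y = G y" if "y \<noteq> x" "y \<noteq> p" for y
    using that by (simp add: G')
  show F': "bht_format T n M G'"
  proof (rule bht_formatI)
    show "rank G' [] = M"
      using F x by (simp add: ry bht_format_def)
  next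
    fix y j assume y: "subtree_at T y = Some (Leaf j)"
    then have "y \<noteq> p" using p by auto
    then show "dims (G' y) = [n ! j, rank G' y]"
      using bht_format_leaf[OF F y] G'y dx rx c by (cases "y = x") (auto simp: ry)
  next
    fix y a b assume y: "subtree_at T y = Some (Node a b)"
    show "dims (G' y) = [rank G' (y @ [False]), rank G' (y @ [True]), rank G' y]"
    proof (cases "y = p")
      case True
      have "rank G' (p @ [u]) = (if u = s then rank G x + dim_col W else rank G (p @ [u]))" for u
        using rx ry[of "p @ [u]"] by (simp add: xp)
      then show ?thesis
        using ry[OF px] by (simp add: True dp Gp q_def xp)
    next
      case yp: False
      have ch: "rank G' (y @ [b]) = rank G (y @ [b])" for b
        using yp by (intro ry) (simp add: xp)
      show ?thesis
      proof (cases "y = x")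
        case True
        then show ?thesis
          using bht_format_node[OF F y] c ch dx rx by auto
      next
        case False
        then show ?thesis
          using bht_format_node[OF F y] yp by (simp add: ch ry G'y)
      qed
    qed
  qed
  show "reconstruct T G' m = reconstruct T G m"
  proof (rule reconstruct_eqI)
    show "hd (dims (G' y)) = hd (dims (G y))" if "is_leaf T y" for y
      using F F' that by (rule hd_dims_leaf_eq)
    show "rank G y \<le> rank G' y" for y
      by (cases "y = x") (simp_all add: rx ry)
  next
    fix i k y
    assume y: "y \<in> nodes T" and k: "\<And>y. y \<in> nodes T - {[]} \<Longrightarrow> k y < rank G y"
    have kx: "k x < rank G x" using k x by simp
    show "core_entry T G' i k y = core_entry T G i k y"
    proof (cases "y = p")
      case True
      have "[k (p @ [False]), k (p @ [True]), k p] ! q = k x"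
        by (cases s) (simp_all add: q_def xp)
      then show ?thesis
        using kx by (simp add: True core_entry_def p G'p entry_pad_zeros_old Gpq)
    next
      case yp: False
      show ?thesis
      proof (cases "y = x")
        case True
        have e: "entry (G' x) (j @ [k x]) = entry (G x) (j @ [k x])" for j
          unfolding G'x using c kx by (rule entry_tensor_of_mat_append_cols)
        show ?thesis
          using e[of "[j]" for j] e[of "[j, j']" for j j']
          by (simp add: True core_entry_def split: dim_tree.split)
      next
        case False
        then show ?thesis using yp by (simp add: core_entry_def G'y)
      qed
    qed
  next
    fix i k y
    assume y: "rank G y \<le> k y" "k y < rank G' y"
    then have "y = x" using ry[of y] by (cases "y = x") simp_all
    with y have kx: "rank G x \<le> k x" by simp
    have "[k (p @ [False]), k (p @ [True]), k p] ! q = k x"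
      by (cases s) (simp_all add: q_def xp)
    then have "core_entry T G' i k p = 0"
      using kx by (simp add: core_entry_def p G'p entry_pad_zeros_new Gpq)
    then show "\<exists>z \<in> nodes T. core_entry T G' i k z = 0"
      using p by (auto simp: nodes_def)
  qed
qed

text \<open>The new slices come after the old ones, so that the batch index \<open>m < M\<close> still selects an old
  slice; all ranks on the edges stay the same.\<close>

lemma append_to_root_preserves:
  assumes F: "bht_format T n M G"
  shows "bht_format T n (M + last (dims C)) (append_to_root G C)"
    and "m < M \<Longrightarrow> reconstruct T (append_to_root G C) m = reconstruct T G m"
proof -
  let ?G = "append_to_root G C"
  have M: "rank G [] = M" using F by (simp add: bht_format_def)
  obtain c where c: "dims (G []) = c @ [M]"
    using bht_format_snoc[OF F root_in_nodes] M by metis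
  have d: "dims (?G []) = c @ [M + last (dims C)]"
    by (simp add: append_to_root_def concat_last_def c)
  have r: "rank ?G [] = M + last (dims C)"
    by (simp add: rank_def d)
  have Gy: "?G y = G y" if "y \<noteq> []" for y
    using that by (simp add: append_to_root_def)
  have ry: "rank ?G y = rank G y" if "y \<noteq> []" for y
    using that by (simp add: rank_def Gy)
  show F': "bht_format T n (M + last (dims C)) ?G"
  proof (rule bht_formatI)
    fix y j assume y: "subtree_at T y = Some (Leaf j)"
    show "dims (?G y) = [n ! j, rank ?G y]"
      using bht_format_leaf[OF F y] c d r Gy ry by (cases "y = []") auto
  next
    fix y a b assume y: "subtree_at T y = Some (Node a b)"
    show "dims (?G y) = [rank ?G (y @ [False]), rank ?G (y @ [True]), rank ?G y]"
      using bht_format_node[OF F y] c d r Gy ry by (cases "y = []") auto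
  qed (rule r)
  assume m: "m < M"
  show "reconstruct T ?G m = reconstruct T G m"
  proof (rule reconstruct_eqI)
    show "hd (dims (?G y)) = hd (dims (G y))" if "is_leaf T y" for y
      using F F' that by (rule hd_dims_leaf_eq)
  next
    fix i :: "nat list" and k :: "path \<Rightarrow> nat" and y :: path
    assume "k [] = m"
    then have e: "entry (?G []) (j @ [k []]) = entry (G []) (j @ [k []])" for j
      using entry_concat_last_old[OF c] m by (simp add: append_to_root_def)
    show "core_entry T ?G i k y = core_entry T G i k y"
      using e[of "[j]" for j] e[of "[j, j']" for j j'] Gy
      by (cases "y = []") (simp_all add: core_entry_def split: dim_tree.split)
  qed (use ry in auto)
qed

section \<open>The batch mode of the projected batch\<close>

lemma length_dims_mode_prod: "length (dims (mode_prod q A X)) = length (dims X)"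
  by (simp add: mode_prod_def)

lemma last_dims_mode_prod:
  assumes "Suc q < length (dims X)"
  shows "last (dims (mode_prod q A X)) = last (dims X)"
  using assms last_list_update[of "dims X" q] by (force simp: mode_prod_def)

lemma dims_contract_layer:
  assumes "length (dims C) = Suc (length (modes T l))"
  shows "length (dims (contract_layer T l G C)) = length (dims C)"
    and "last (dims (contract_layer T l G C)) = last (dims C)"
proof -
  let ?f = "\<lambda>x. mode_prod (mode_of T l x) (transpose_mat (core_mat G x))"
  have "length (dims (fold ?f xs C)) = length (dims C) \<and> last (dims (fold ?f xs C)) = last (dims C)"
    if "set xs \<subseteq> set (modes T l)" for xs
    using that assms
  proof (induction xs arbitrary: C)
    case (Cons x xs)
    then show ?case
      using mode_of_less[of x T l] by (simp add: length_dims_mode_prod last_dims_mode_prod)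
  qed simp
  from this[of "layer T l"]
  show "length (dims (contract_layer T l G C)) = length (dims C)"
    and "last (dims (contract_layer T l G C)) = last (dims C)"
    by (auto simp: contract_layer_def layer_def)
qed

lemma last_dims_process_layer:
  assumes "length (dims C) = Suc (length (modes T l))"
  shows "last (dims (process_layer T l G C)) = last (dims C)"
  using dims_contract_layer[OF assms]
  by (simp add: process_layer_def merge_siblings_def reshape_def Let_def)

text \<open>Merging siblings restores the one-to-one correspondence between modes and \<open>modes T l\<close>. Layer 1 is
  contracted without merging, hence \<open>l > 0\<close>.\<close>

lemma length_dims_process_layer:
  assumes "length (dims C) = Suc (length (modes T (Suc l)))" and "l > 0"
  shows "length (dims (process_layer T (Suc l) G C)) = Suc (length (modes T l))"
  using assms by (simp add: process_layer_def merge_siblings_def reshape_def Let_def)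

lemma last_dims_project:
  assumes "length (dims C) = Suc (length (modes T l))"
  shows "last (dims (project T G l C)) = last (dims C)"
  using assms
proof (induction l arbitrary: C)
  case (Suc l)
  have last: "last (dims (process_layer T (Suc l) G C)) = last (dims C)"
    using Suc.prems by (rule last_dims_process_layer)
  show ?case
  proof (cases "l = 0")
    case True
    then show ?thesis using last by simp
  next
    case False
    then show ?thesis
      using Suc.IH length_dims_process_layer[OF Suc.prems] last by simp
  qed
qed simp

section \<open>Updates over layers and time\<close>

lemma layer_subset_nodes: "set (layer T (Suc l)) \<subseteq> nodes T - {[]}"
  using modes_subset_nodes[of T "Suc l"] by (auto simp: layer_def)

lemma expand_nodes_preserves:
  assumes "bht_format T n M G" and "set xs \<subseteq> nodes T - {[]}" and "expand_nodes T \<delta> l C xs G G'"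
  shows "bht_format T n M G' \<and> reconstruct T G' m = reconstruct T G m"
  using assms
proof (induction xs arbitrary: G)
  case (Cons x xs)
  then obtain G1 where G1: "expand_node T \<delta> l C x G G1" "expand_nodes T \<delta> l C xs G1 G'"
    by auto
  have x: "x \<in> nodes T" "x \<noteq> []" using Cons.prems(2) by auto
  note step = expand_node_preserves[OF Cons.prems(1) x G1(1)]
  show ?case
    using Cons.IH[OF step(1) _ G1(2)] Cons.prems(2) step(2) by simp
qed simp

text \<open>When layer \<open>l\<close> is reached, its cores have been padded by the layer below. The cores \<open>G\<close> are
  therefore arbitrary cores of the right format, whose ranks may exceed those before the update.\<close>

lemma expand_preserves:
  assumes "bht_format T n M G" and "length (dims C) = Suc (length (modes T l))"
    and "expand T \<delta> l G C G' C'"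
  shows "bht_format T n M G' \<and> reconstruct T G' m = reconstruct T G m \<and>
    last (dims C') = last (dims C)"
  using assms
proof (induction l arbitrary: G C)
  case (Suc l)
  then obtain G1 where G1: "expand_nodes T \<delta> (Suc l) C (layer T (Suc l)) G G1"
    and E: "expand T \<delta> l G1 (process_layer T (Suc l) G1 C) G' C'"
    by auto
  have nodes: "bht_format T n M G1 \<and> reconstruct T G1 m = reconstruct T G m"
    using Suc.prems(1) layer_subset_nodes G1 by (rule expand_nodes_preserves)
  have last: "last (dims (process_layer T (Suc l) G1 C)) = last (dims C)"
    using Suc.prems(2) by (rule last_dims_process_layer)
  show ?case
  proof (cases "l = 0")
    case True
    then show ?thesis using E nodes last by simp
  next
    case False
    then show ?thesis
      using Suc.IH[OF _ _ E] nodes last length_dims_process_layer[OF Suc.prems(2)] by simp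
  qed
qed simp

lemma ht_rise_step_preserves:
  assumes F: "bht_format T n M G" and Y: "length (dims Y) = Suc (length (leaf_dims T))"
    and step: "ht_rise_step T \<epsilon> G Y G'"
  shows "bht_format T n (M + last (dims Y)) G'"
    and "m < M \<Longrightarrow> reconstruct T G' m = reconstruct T G m"
proof -
  have Y': "length (dims Y) = Suc (length (modes T (height T)))"
    using Y by (simp add: length_modes_height)
  obtain G1 C where G1: "bht_format T n M G1" "\<And>m. reconstruct T G1 m = reconstruct T G m"
    and C: "last (dims C) = last (dims Y)" and G': "G' = append_to_root G1 C"
    using step F last_dims_project[OF Y'] expand_preserves[OF F Y']
    by (simp add: ht_rise_step_def Let_def split: if_splits) blast+
  show "bht_format T n (M + last (dims Y)) G'"
    using append_to_root_preserves(1)[OF G1(1), of C] by (simp add: G' C)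
  show "reconstruct T G' m = reconstruct T G m" if "m < M"
    using append_to_root_preserves(2)[OF G1(1) that, of C] by (simp add: G' G1(2))
qed

lemma last_dims_accumulation_Suc:
  assumes "k \<ge> 1"
  shows "last (dims (accumulation Y (Suc k))) = last (dims (accumulation Y k)) + last (dims (Y (Suc k)))"
  using assms by (simp add: accumulation_def concat_last_def)

lemma last_dims_accumulation_mono:
  assumes "1 \<le> k" and "k \<le> t"
  shows "last (dims (accumulation Y k)) \<le> last (dims (accumulation Y t))"
  using assms(2,1) by (induction t rule: dec_induct) (auto simp: last_dims_accumulation_Suc)

lemma ht_rise_stepD:
  assumes "ht_rise T \<epsilon> Y H" and "1 \<le> k"
  shows "ht_rise_step T \<epsilon> (H k) (Y (Suc k)) (H (Suc k))"
proof -
  have "\<forall>j \<ge> 2. ht_rise_step T \<epsilon> (H (j - 1)) (Y j) (H j)"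
    using assms(1) unfolding ht_rise_def by blast
  from this[rule_format, of "Suc k"] show ?thesis
    using assms(2) by simp
qed

text \<open>Every tensor accumulated so far has its root slice.\<close>

lemma ht_rise_format:
  assumes H: "ht_rise T \<epsilon> Y H" and Y: "\<And>i. i \<ge> 1 \<Longrightarrow> dims (Y i) = n @ [N i]"
    and n: "length n = length (leaf_dims T)" and k: "k \<ge> 1"
  shows "bht_format T n (last (dims (accumulation Y k))) (H k)"
  using k
proof (induction k rule: dec_induct)
  case base
  then show ?case using H Y by (simp add: ht_rise_def accumulation_def)
next
  case (step k)
  have "ht_rise_step T \<epsilon> (H k) (Y (Suc k)) (H (Suc k))"
    using H step.hyps(1) by (rule ht_rise_stepD)
  with step.IH _ have "bht_format T n (last (dims (accumulation Y k)) + last (dims (Y (Suc k)))) (H (Suc k))"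
    by (rule ht_rise_step_preserves) (use Y n in simp)
  then show ?case using step.hyps by (simp add: last_dims_accumulation_Suc)
qed

theorem theorem6:
  fixes T :: dim_tree and d :: nat and n :: "nat list" and N :: "nat \<Rightarrow> nat"
    and Y :: "nat \<Rightarrow> tensor" and \<epsilon>_rel :: real and H :: "nat \<Rightarrow> bht" and k t m :: nat
  assumes "d \<ge> 2" and "length n = d"
    and "leaf_dims T = [0..<d]" and "balanced T"
    and "\<And>i. i \<ge> 1 \<Longrightarrow> dims (Y i) = n @ [N i]"
    and "ht_rise T \<epsilon>_rel Y H"
    and "1 \<le> k" and "k \<le> t"
    and "m < last (dims (accumulation Y k))"
  shows "reconstruct T (H k) m = reconstruct T (H t) m"
  using \<open>k \<le> t\<close>
proof (induction t rule: dec_induct)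
  case (step t)
  have n: "length n = length (leaf_dims T)" using assms(2,3) by simp
  have t: "1 \<le> t" using assms(7) step.hyps by simp
  have "reconstruct T (H (Suc t)) m = reconstruct T (H t) m"
  proof (rule ht_rise_step_preserves(2))
    show "bht_format T n (last (dims (accumulation Y t))) (H t)"
      using assms(6,5) n t by (rule ht_rise_format)
    show "length (dims (Y (Suc t))) = Suc (length (leaf_dims T))"
      using assms(5) n by simp
    show "ht_rise_step T \<epsilon>_rel (H t) (Y (Suc t)) (H (Suc t))"
      using assms(6) t by (rule ht_rise_stepD)
    show "m < last (dims (accumulation Y t))"
      using assms(9) last_dims_accumulation_mono[OF assms(7) step.hyps(1)] by (rule less_le_trans)
  qed
  then show ?case using step.IH by simp
qed simp

end
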